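(* Let $G$ be a bridgeless cubic graph having a $2$-factor all of whose cycles are chordless cycles of length $5$. If the multigraph $G^*$ has chromatic index $5$, then $G$ has a Fulkerson covering.
   Context: $G^*$ denotes the multigraph obtained from $G$ by contracting each $5$-cycle of the given $2$-factor to a single vertex (the remaining edges, which form the perfect matching complementary to the $2$-factor, become the edges of $G^*$); $G^*$ is $5$-regular. A Fulkerson covering of $G$ is a family of $6$ perfect matchings of $G$ (not necessarily distinct) such that every edge of $G$ lies in exactly two of them. *)

theory Defs
  imports Main
begin

text \<open>Undirected multigraphs: edges have their own identity, and \<open>ends\<close> gives the set of
  end vertices of an edge (a singleton for a loop).\<close>

record ('v, 'e) multigraph =
  verts :: "'v set"
  edges :: "'e set"
  ends :: "'e \<Rightarrow> 'v set"

definition finite_multigraph :: "('v, 'e) multigraph \<Rightarrow> bool" where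
  "finite_multigraph G \<longleftrightarrow>
     finite (verts G) \<and> finite (edges G) \<and>
     (\<forall>e\<in>edges G. ends G e \<subseteq> verts G \<and> card (ends G e) \<in> {1, 2})"

text \<open>A loop contributes 2 to the degree.\<close>

definition degree :: "('v, 'e) multigraph \<Rightarrow> 'v \<Rightarrow> nat" where
  "degree G v = card {e \<in> edges G. v \<in> ends G e} + card {e \<in> edges G. ends G e = {v}}"

definition regular :: "('v, 'e) multigraph \<Rightarrow> nat \<Rightarrow> bool" where
  "regular G k \<longleftrightarrow> (\<forall>v\<in>verts G. degree G v = k)"

abbreviation cubic :: "('v, 'e) multigraph \<Rightarrow> bool" where
  "cubic G \<equiv> regular G 3"

definition spanning_subgraph :: "('v, 'e) multigraph \<Rightarrow> 'e set \<Rightarrow> ('v, 'e) multigraph" where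
  "spanning_subgraph G F = G\<lparr>edges := F\<rparr>"

definition induced_subgraph :: "('v, 'e) multigraph \<Rightarrow> 'v set \<Rightarrow> ('v, 'e) multigraph" where
  "induced_subgraph G X = G\<lparr>verts := X, edges := {e \<in> edges G. ends G e \<subseteq> X}\<rparr>"

definition adjacency :: "('v, 'e) multigraph \<Rightarrow> ('v \<times> 'v) set" where
  "adjacency G = {(u, v). \<exists>e\<in>edges G. ends G e = {u, v}}"

definition connection :: "('v, 'e) multigraph \<Rightarrow> ('v \<times> 'v) set" where
  "connection G = {(u, v). u \<in> verts G \<and> v \<in> verts G \<and> (u, v) \<in> (adjacency G)\<^sup>*}"

text \<open>Vertex sets of the connected components.\<close>

definition components :: "('v, 'e) multigraph \<Rightarrow> 'v set set" where
  "components G = verts G // connection G"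

definition bridge :: "('v, 'e) multigraph \<Rightarrow> 'e \<Rightarrow> bool" where
  "bridge G e \<longleftrightarrow> e \<in> edges G \<and>
     card (components (spanning_subgraph G (edges G - {e}))) > card (components G)"

definition bridgeless :: "('v, 'e) multigraph \<Rightarrow> bool" where
  "bridgeless G \<longleftrightarrow> (\<forall>e\<in>edges G. \<not> bridge G e)"

definition is_cycle :: "('v, 'e) multigraph \<Rightarrow> nat \<Rightarrow> bool" where
  "is_cycle C k \<longleftrightarrow> k \<ge> 1 \<and>
     (\<exists>v e. bij_betw v {..<k} (verts C) \<and> bij_betw e {..<k} (edges C) \<and>
        (\<forall>i<k. ends C (e i) = {v i, v (Suc i mod k)}))"

text \<open>An edge of \<open>G\<close> parallel to an edge of \<open>C\<close> counts as a chord.\<close>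

definition chordless :: "('v, 'e) multigraph \<Rightarrow> ('v, 'e) multigraph \<Rightarrow> bool" where
  "chordless G C \<longleftrightarrow> \<not> (\<exists>e\<in>edges G - edges C. ends G e \<subseteq> verts C)"

text \<open>A factor is given by its edge set.\<close>

definition two_factor :: "('v, 'e) multigraph \<Rightarrow> 'e set \<Rightarrow> bool" where
  "two_factor G F \<longleftrightarrow> F \<subseteq> edges G \<and> regular (spanning_subgraph G F) 2"

definition factor_components ::
    "('v, 'e) multigraph \<Rightarrow> 'e set \<Rightarrow> ('v, 'e) multigraph set" where
  "factor_components G F =
     induced_subgraph (spanning_subgraph G F) ` components (spanning_subgraph G F)"

definition perfect_matching :: "('v, 'e) multigraph \<Rightarrow> 'e set \<Rightarrow> bool" where
  "perfect_matching G M \<longleftrightarrow> M \<subseteq> edges G \<and> regular (spanning_subgraph G M) 1"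

text \<open>Each component of the factor \<open>F\<close> becomes one vertex, represented by its vertex set;
  the edges outside \<open>F\<close> keep their identity. For a 2-factor \<open>F\<close> of a cubic graph \<open>G\<close> this
  is the multigraph \<open>G\<^sup>*\<close>.\<close>

definition contract :: "('v, 'e) multigraph \<Rightarrow> 'e set \<Rightarrow> ('v set, 'e) multigraph" where
  "contract G F =
     \<lparr>verts = components (spanning_subgraph G F),
      edges = edges G - F,
      ends = (\<lambda>e. {X \<in> components (spanning_subgraph G F). X \<inter> ends G e \<noteq> {}})\<rparr>"

definition proper_edge_colouring :: "('v, 'e) multigraph \<Rightarrow> nat \<Rightarrow> ('e \<Rightarrow> nat) \<Rightarrow> bool" where
  "proper_edge_colouring G k c \<longleftrightarrow> c ` edges G \<subseteq> {..<k} \<and>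
     (\<forall>e\<in>edges G. \<forall>f\<in>edges G. e \<noteq> f \<longrightarrow> ends G e \<inter> ends G f \<noteq> {} \<longrightarrow> c e \<noteq> c f)"

definition chromatic_index :: "('v, 'e) multigraph \<Rightarrow> nat" where
  "chromatic_index G = (LEAST k. \<exists>c. proper_edge_colouring G k c)"

text \<open>The minimum in \<open>chromatic_index\<close> is attained.\<close>

lemma chromatic_index_colouring:
  assumes "finite (edges G)"
  shows "\<exists>c. proper_edge_colouring G (chromatic_index G) c"
proof -
  obtain c where "bij_betw c (edges G) {0..<card (edges G)}"
    using ex_bij_betw_finite_nat[OF assms] by blast
  then have "proper_edge_colouring G (card (edges G)) c"
    by (auto simp: proper_edge_colouring_def bij_betw_def inj_on_def)
  then have "\<exists>k c. proper_edge_colouring G k c" by blast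
  then show ?thesis
    unfolding chromatic_index_def by (rule LeastI_ex)
qed

text \<open>The family is indexed, so that its members need not be distinct.\<close>

definition fulkerson_covering :: "('v, 'e) multigraph \<Rightarrow> (nat \<Rightarrow> 'e set) \<Rightarrow> bool" where
  "fulkerson_covering G M \<longleftrightarrow>
     (\<forall>i<6. perfect_matching G (M i)) \<and>
     (\<forall>e\<in>edges G. card {i. i < 6 \<and> e \<in> M i} = 2)"

end

theory Submission
  imports Defs
begin

text \<open>At every 5-cycle of the 2-factor \<open>F\<close> the five incident edges of the complementary perfect
  matching carry five different colours, since no chord joins two vertices of the cycle. Hence for
  each colour \<open>k\<close> every cycle has exactly one vertex \<open>w\<close> whose matching edge is coloured \<open>k\<close>, and
  the path obtained by deleting \<open>w\<close> from the cycle has a unique perfect matching \<open>Q w\<close>. The edges of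
  colour \<open>k\<close> together with these sets \<open>Q w\<close> form a perfect matching. These five perfect matchings,
  and the complement of \<open>F\<close> as the sixth, cover every edge exactly twice: a cycle edge lies in
  \<open>Q w\<close> for exactly two vertices \<open>w\<close> of its cycle.\<close>

section \<open>Perfect matchings and degrees\<close>

lemma perfect_matching_iff:
  assumes "finite_multigraph G"
  shows "perfect_matching G M \<longleftrightarrow>
    M \<subseteq> edges G \<and> (\<forall>u\<in>verts G. (\<exists>!e. e \<in> M \<and> u \<in> ends G e) \<and> (\<forall>e\<in>M. ends G e \<noteq> {u}))"
proof -
  have "card {e \<in> M. u \<in> ends G e} + card {e \<in> M. ends G e = {u}} = 1 \<longleftrightarrow>
      (\<exists>!e. e \<in> M \<and> u \<in> ends G e) \<and> (\<forall>e\<in>M. ends G e \<noteq> {u})" (is "?l \<longleftrightarrow> ?r")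
    if "M \<subseteq> edges G" for u
  proof -
    have fin: "finite M"
      using assms that by (auto simp: finite_multigraph_def intro: finite_subset)
    \<comment> \<open>A loop at \<open>u\<close> is counted in both sets, so a degree of 1 cannot
      come from the second summand alone: the sum 1 splits only as 1 + 0.\<close>
    have le: "card {e \<in> M. ends G e = {u}} \<le> card {e \<in> M. u \<in> ends G e}"
      using fin by (intro card_mono) auto
    have "?l \<longleftrightarrow> card {e \<in> M. u \<in> ends G e} = Suc 0 \<and> card {e \<in> M. ends G e = {u}} = 0"
      using le by linarith
    also have "\<dots> \<longleftrightarrow> ?r"
    proof -
      have "card {e \<in> M. u \<in> ends G e} = Suc 0 \<longleftrightarrow> (\<exists>!e. e \<in> M \<and> u \<in> ends G e)"
        by (auto simp: card_1_singleton_iff Ex1_def set_eq_iff)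
      moreover have "card {e \<in> M. ends G e = {u}} = 0 \<longleftrightarrow> (\<forall>e\<in>M. ends G e \<noteq> {u})"
        using fin by auto
      ultimately show ?thesis
        by simp
    qed
    finally show ?thesis .
  qed
  then show ?thesis
    by (simp add: perfect_matching_def regular_def degree_def spanning_subgraph_def cong: conj_cong)
qed

text \<open>Degree, loops included, is additive over the partition of \<open>edges G\<close> into
  \<open>F\<close> and its complement, which leaves 3 - 2 = 1 at every vertex. Besides being the
  sixth matching, this set attaches to each vertex the edge that gives it a colour.\<close>

lemma complement_two_factor_perfect_matching:
  assumes "finite_multigraph G" and "cubic G" and "two_factor G F"
  shows "perfect_matching G (edges G - F)"
proof -
  have F: "F \<subseteq> edges G" and fin: "finite (edges G)"
    using assms by (auto simp: two_factor_def finite_multigraph_def)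
  have split: "card {e \<in> edges G. P e} = card {e \<in> F. P e} + card {e \<in> edges G - F. P e}" for P
  proof -
    have "{e \<in> edges G. P e} = {e \<in> F. P e} \<union> {e \<in> edges G - F. P e}"
      using F by auto
    then show ?thesis
      using fin F by (auto simp: card_Un_disjoint finite_subset Int_def)
  qed
  have "degree G u = degree (spanning_subgraph G F) u + degree (spanning_subgraph G (edges G - F)) u"
    for u
    using split[of "\<lambda>e. u \<in> ends G e"] split[of "\<lambda>e. ends G e = {u}"]
    by (simp add: degree_def spanning_subgraph_def)
  then have "degree (spanning_subgraph G (edges G - F)) u = 1" if "u \<in> verts G" for u
    using assms(2,3) that by (auto simp: two_factor_def regular_def spanning_subgraph_def)
  then show ?thesis
    by (simp add: perfect_matching_def regular_def spanning_subgraph_def)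
qed

section \<open>Connected components as equivalence classes\<close>

lemma equiv_connection:
  "equiv (verts G) (connection G)"
proof -
  have "sym (adjacency G)"
    by (auto simp: adjacency_def sym_def insert_commute)
  then have "sym ((adjacency G)\<^sup>*)"
    by (rule sym_rtrancl)
  then show ?thesis
    by (auto simp: equiv_def connection_def refl_on_def intro!: symI transI dest: symD
        intro: rtrancl_trans)
qed

text \<open>The ends of one edge are related by \<open>connection G\<close>, so a class containing
  one of them contains the other. Applied to the 2-factor, this places each edge of \<open>F\<close>
  inside a single cycle.\<close>

lemma component_ends_subset:
  assumes "finite_multigraph G" and "X \<in> components G" and "e \<in> edges G"
    and "u \<in> ends G e" and "u \<in> X"
  shows "ends G e \<subseteq> X"
proof
  fix v assume v: "v \<in> ends G e"
  have sub: "ends G e \<subseteq> verts G" and card: "card (ends G e) \<in> {1, 2}"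
    using assms by (auto simp: finite_multigraph_def)
  have "u = v \<or> ends G e = {u, v}"
    using card v assms(4) by (auto simp: card_1_singleton_iff card_2_iff)
  then have "(u, v) \<in> (adjacency G)\<^sup>*"
    using assms(3) by (auto simp: adjacency_def)
  then have "(u, v) \<in> connection G"
    using sub v assms(4) by (auto simp: connection_def)
  then show "v \<in> X"
    using assms(2,5) equiv_connection unfolding components_def
    by (meson in_quotient_imp_closed)
qed

lemma Union_components: "\<Union> (components G) = verts G"
  unfolding components_def by (rule Union_quotient[OF equiv_connection])

lemma components_eq:
  assumes "X \<in> components G" "Y \<in> components G" "u \<in> X" "u \<in> Y"
  shows "X = Y"
  using quotient_disj[OF equiv_connection] assms unfolding components_def by blast

section \<open>Matchings of a 5-cycle that miss one vertex\<close>

lemma less_5_cases: "(i::nat) < 5 \<longleftrightarrow> i = 0 \<or> i = 1 \<or> i = 2 \<or> i = 3 \<or> i = 4"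
  by auto

lemma five_cycle_near_matchings:
  assumes "is_cycle C 5"
  obtains Q where
    "\<And>w. w \<in> verts C \<Longrightarrow> Q w \<subseteq> edges C"
    and "\<And>w e. w \<in> verts C \<Longrightarrow> e \<in> Q w \<Longrightarrow> w \<notin> ends C e"
    and "\<And>w u. w \<in> verts C \<Longrightarrow> u \<in> verts C \<Longrightarrow> u \<noteq> w \<Longrightarrow> \<exists>!e. e \<in> Q w \<and> u \<in> ends C e"
    and "\<And>e. e \<in> edges C \<Longrightarrow> card {w \<in> verts C. e \<in> Q w} = 2"
proof -
  obtain v e where v: "bij_betw v {..<5} (verts C)" and e: "bij_betw e {..<5} (edges C)"
    and ends: "\<And>i. i < 5 \<Longrightarrow> ends C (e i) = {v i, v (Suc i mod 5)}"
    using assms unfolding is_cycle_def by blast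
  \<comment> \<open>Edge \<open>e i\<close> joins \<open>v i\<close> to its successor. Deleting
    \<open>v j\<close> leaves a path from \<open>v (j+1)\<close> to \<open>v (j+4)\<close> (indices
    mod 5), whose perfect matching consists of its first and last edges, with indices j+1 and
    j+3.\<close>
  define S where "S j = {(j + 1) mod 5, (j + 3) mod 5}" for j :: nat
  define Q where "Q w = {e t | t j. j < 5 \<and> w = v j \<and> t \<in> S j}" for w
  have veq: "v i = v j \<longleftrightarrow> i = j" and eeq: "e i = e j \<longleftrightarrow> i = j" if "i < 5" "j < 5" for i j
    using v e that by (auto simp: bij_betw_def inj_on_def)
  have vC: "\<exists>i<5. w = v i" if "w \<in> verts C" for w
    using v that by (auto simp: bij_betw_def)
  have eC: "\<exists>i<5. f = e i" if "f \<in> edges C" for f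
    using e that by (auto simp: bij_betw_def)
  have Qv: "Q (v j) = e ` S j" if "j < 5" for j
    using that veq by (auto simp: Q_def)
  have S5: "t < 5" if "t \<in> S j" for t j
    using that by (auto simp: S_def)
  have in_ends: "v i \<in> ends C (e t) \<longleftrightarrow> i = t \<or> i = Suc t mod 5" if "i < 5" "t < 5" for i t
    using that by (simp add: ends veq)
  have eQ: "e t \<in> Q (v j) \<longleftrightarrow> t \<in> S j" if "t < 5" "j < 5" for t j
    using that S5 by (auto simp: Qv eeq)
  show ?thesis
  proof
    show "Q w \<subseteq> edges C" if "w \<in> verts C" for w
      using e S5 by (auto simp: Q_def bij_betw_def)
    show "w \<notin> ends C f" if w: "w \<in> verts C" and f: "f \<in> Q w" for w f
    proof -
      obtain j where j: "j < 5" "w = v j"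
        using vC w by blast
      obtain t where t: "t \<in> S j" "f = e t"
        using f j Qv by auto
      have "\<not> (j = t \<or> j = Suc t mod 5)"
        using j(1) t(1) by (auto simp: S_def less_5_cases)
      then show ?thesis
        using j t S5 in_ends by auto
    qed
    show "\<exists>!f. f \<in> Q w \<and> u \<in> ends C f" if w: "w \<in> verts C" and u: "u \<in> verts C" "u \<noteq> w" for w u
    proof -
      obtain j where j: "j < 5" "w = v j"
        using vC w by blast
      obtain i where i: "i < 5" "u = v i"
        using vC u by blast
      have "i \<noteq> j"
        using i j u by auto
      \<comment> \<open>The inequality of truth values is an exclusive or: \<open>v i\<close> is an
        end of exactly one of the two chosen edges.\<close>
      then have "(i = (j + 1) mod 5 \<or> i = Suc ((j + 1) mod 5) mod 5) \<noteq>
          (i = (j + 3) mod 5 \<or> i = Suc ((j + 3) mod 5) mod 5)"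
        using i(1) j(1) unfolding less_5_cases by (elim disjE) simp_all
      then have "\<exists>!t. t \<in> S j \<and> (i = t \<or> i = Suc t mod 5)"
        unfolding S_def by blast
      then obtain t where t: "t \<in> S j" "i = t \<or> i = Suc t mod 5"
        and uniq: "\<And>s. s \<in> S j \<Longrightarrow> i = s \<or> i = Suc s mod 5 \<Longrightarrow> s = t"
        by blast
      show ?thesis
      proof (intro ex1I[of _ "e t"])
        show "e t \<in> Q w \<and> u \<in> ends C (e t)"
          using i j t S5[OF t(1)] by (simp add: eQ in_ends)
        show "f = e t" if "f \<in> Q w \<and> u \<in> ends C f" for f
          using that i j Qv S5 uniq in_ends by auto
      qed
    qed
    show "card {w \<in> verts C. f \<in> Q w} = 2" if f: "f \<in> edges C" for f
    proof -
      obtain t where t: "t < 5" "f = e t"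
        using eC f by blast
      have "{w \<in> verts C. f \<in> Q w} = v ` {j \<in> {..<5}. t \<in> S j}"
        using t eQ vC bij_betwE[OF v] by fastforce
      moreover have "inj_on v {j \<in> {..<5}. t \<in> S j}"
        using veq by (auto simp: inj_on_def)
      \<comment> \<open>Solving t = j + 1 and t = j + 3 modulo 5 for j gives t - 1 and t - 3,
        written without subtraction on the naturals.\<close>
      moreover have "t \<in> S j \<longleftrightarrow> j \<in> {(t + 4) mod 5, (t + 2) mod 5}" if "j < 5" for j
        using t(1) that unfolding S_def less_5_cases by (elim disjE) simp_all
      then have "{j \<in> {..<5}. t \<in> S j} = {(t + 4) mod 5, (t + 2) mod 5}"
        by auto
      moreover have "(t + 4) mod 5 \<noteq> (t + 2) mod 5"
        using t(1) by (auto simp: less_5_cases)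
      ultimately show ?thesis
        by (simp add: card_image)
    qed
  qed
qed

theorem theorem5p1:
  fixes G :: "('v, 'e) multigraph" and F :: "'e set"
  assumes "finite_multigraph G" and "cubic G" and "bridgeless G"
    and "two_factor G F"
    and "\<forall>C\<in>factor_components G F. is_cycle C 5 \<and> chordless G C"
    and "chromatic_index (contract G F) = 5"
  shows "\<exists>M. fulkerson_covering G M"
proof -
  define H where "H = spanning_subgraph G F"
  define K where "K X = induced_subgraph H X" for X
  have F: "F \<subseteq> edges G"
    using assms(4) by (simp add: two_factor_def)
  have H_simps [simp]: "verts H = verts G" "edges H = F" "ends H = ends G"
    by (simp_all add: H_def spanning_subgraph_def)
  have K_simps [simp]: "verts (K X) = X" "edges (K X) = {e \<in> F. ends G e \<subseteq> X}"
    "ends (K X) = ends G" for X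
    by (simp_all add: K_def induced_subgraph_def)
  have finH: "finite_multigraph H"
    using assms(1) F by (auto simp: finite_multigraph_def intro: finite_subset)
  have ends_G: "ends G e \<subseteq> verts G" "card (ends G e) = 1 \<or> card (ends G e) = 2"
    if "e \<in> edges G" for e
    using assms(1) that by (auto simp: finite_multigraph_def)
  have cyc: "is_cycle (K X) 5" and chordless: "chordless G (K X)" if "X \<in> components H" for X
    using assms(5) that by (auto simp: factor_components_def K_def H_def)

  \<comment> \<open>Colours of the matching edges around a cycle\<close>
  have pm: "perfect_matching G (edges G - F)"
    by (rule complement_two_factor_perfect_matching[OF assms(1,2,4)])
  define m where "m u = (THE e. e \<in> edges G - F \<and> u \<in> ends G e)" for u
  have m_ex1: "\<exists>!e. e \<in> edges G - F \<and> u \<in> ends G e"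
    and no_loop: "\<And>e. e \<in> edges G - F \<Longrightarrow> ends G e \<noteq> {u}" if "u \<in> verts G" for u
    using pm that unfolding perfect_matching_iff[OF assms(1)] by blast+
  have m: "m u \<in> edges G - F" "u \<in> ends G (m u)" if "u \<in> verts G" for u
    using theI'[OF m_ex1[OF that]] by (auto simp: m_def)
  have m_eq: "e = m u" if "u \<in> verts G" "e \<in> edges G - F" "u \<in> ends G e" for e u
    using m[OF that(1)] m_ex1[OF that(1)] that by blast

  obtain c where c: "proper_edge_colouring (contract G F) 5 c"
    using chromatic_index_colouring[of "contract G F"] assms(1,6)
    by (auto simp: contract_def finite_multigraph_def)
  define col where "col u = c (m u)" for u
  have c5: "c e < 5" if "e \<in> edges G - F" for e
    using c that by (auto simp: proper_edge_colouring_def contract_def)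
  have X_sub: "X \<subseteq> verts G" if "X \<in> components H" for X
    using Union_components[of H] that by auto
  have m_inj: "m u \<noteq> m u'" if X: "X \<in> components H" and u: "u \<in> X" "u' \<in> X" "u \<noteq> u'" for X u u'
  proof
    assume eq: "m u = m u'"
    have V: "u \<in> verts G" "u' \<in> verts G"
      using X_sub X u by auto
    \<comment> \<open>A matching edge shared by two vertices of \<open>X\<close> lies outside
      \<open>F\<close> with both ends in \<open>X\<close>, hence is a chord.\<close>
    have "ends G (m u) = {u, u'}"
      using ends_G(2)[of "m u"] m[OF V(1)] m[OF V(2)] eq u(3)
      by (auto simp: card_1_singleton_iff card_2_iff)
    then show False
      using chordless[OF X] m[OF V(1)] u by (auto simp: chordless_def)
  qed
  have col_inj: "inj_on col X" if X: "X \<in> components H" for X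
  proof (rule inj_onI, rule ccontr)
    fix u u' assume u: "u \<in> X" "u' \<in> X" "col u = col u'" "u \<noteq> u'"
    have V: "u \<in> verts G" "u' \<in> verts G"
      using X_sub X u by auto
    \<comment> \<open>After contraction both matching edges meet at the vertex \<open>X\<close>, so
      properness separates their colours.\<close>
    have "X \<in> ends (contract G F) (m u)" "X \<in> ends (contract G F) (m u')"
      using X u m V by (auto simp: contract_def H_def)
    moreover have "m u \<in> edges (contract G F)" "m u' \<in> edges (contract G F)"
      using m V by (auto simp: contract_def)
    ultimately show False
      using c m_inj[OF X u(1,2,4)] u(3) unfolding proper_edge_colouring_def col_def by blast
  qed
  have col_surj: "\<exists>w\<in>X. col w = k" if X: "X \<in> components H" and k: "k < 5" for X k
  proof -
    have "card X = 5"
      using cyc[OF X] by (auto simp: is_cycle_def dest: bij_betw_same_card)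
    then have "card (col ` X) = card {..<5::nat}"
      using col_inj[OF X] by (simp add: card_image)
    moreover have "col ` X \<subseteq> {..<5}"
      using c5 m X_sub[OF X] by (auto simp: col_def)
    ultimately have "col ` X = {..<5}"
      by (intro card_subset_eq) auto
    then show ?thesis
      using k by (metis imageE lessThan_iff)
  qed

  \<comment> \<open>Near matchings chosen in every cycle\<close>
  define near where "near X q \<longleftrightarrow>
      (\<forall>w\<in>X. q w \<subseteq> {e \<in> F. ends G e \<subseteq> X} \<and> (\<forall>e\<in>q w. w \<notin> ends G e) \<and>
        (\<forall>u\<in>X. u \<noteq> w \<longrightarrow> (\<exists>!e. e \<in> q w \<and> u \<in> ends G e))) \<and>
      (\<forall>e\<in>F. ends G e \<subseteq> X \<longrightarrow> card {w \<in> X. e \<in> q w} = 2)"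
    for X and q :: "'v \<Rightarrow> 'e set"
  have "\<exists>q. near X q" if X: "X \<in> components H" for X
  proof -
    obtain q where
      "\<And>w. w \<in> X \<Longrightarrow> q w \<subseteq> {e \<in> F. ends G e \<subseteq> X}"
      "\<And>w e. w \<in> X \<Longrightarrow> e \<in> q w \<Longrightarrow> w \<notin> ends G e"
      "\<And>w u. w \<in> X \<Longrightarrow> u \<in> X \<Longrightarrow> u \<noteq> w \<Longrightarrow> \<exists>!e. e \<in> q w \<and> u \<in> ends G e"
      "\<And>e. e \<in> {e \<in> F. ends G e \<subseteq> X} \<Longrightarrow> card {w \<in> X. e \<in> q w} = 2"
      by (rule five_cycle_near_matchings[OF cyc[OF X], unfolded K_simps]) (rule that)
    then have "near X q"
      by (simp add: near_def)
    then show ?thesis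
      by (rule exI[of "near X"])
  qed
  \<comment> \<open>Bundling the four properties into the single predicate \<open>near\<close> lets
    one choice function serve all components.\<close>
  then obtain Q where Q: "\<And>X. X \<in> components H \<Longrightarrow> near X (Q X)"
    by metis
  have Q_sub: "Q X w \<subseteq> {e \<in> F. ends G e \<subseteq> X}"
    and Q_avoid: "\<And>e. e \<in> Q X w \<Longrightarrow> w \<notin> ends G e"
    and Q_ex1: "\<And>u. u \<in> X \<Longrightarrow> u \<noteq> w \<Longrightarrow> \<exists>!e. e \<in> Q X w \<and> u \<in> ends G e"
    if "X \<in> components H" "w \<in> X" for X w
    using Q[OF that(1)] that(2) unfolding near_def by blast+
  have Q_card: "card {w \<in> X. e \<in> Q X w} = 2"
    if "X \<in> components H" "e \<in> F" "ends G e \<subseteq> X" for X e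
    using Q[OF that(1)] that(2,3) unfolding near_def by blast
  have F_ends: "\<exists>X\<in>components H. ends G e \<subseteq> X \<and> (\<exists>u. u \<in> ends G e)" if "e \<in> F" for e
  proof -
    have e: "e \<in> edges G"
      using F that by blast
    then obtain u where u: "u \<in> ends G e"
      using ends_G(2)[of e] by fastforce
    moreover obtain X where X: "X \<in> components H" "u \<in> X"
      using Union_components[of H] ends_G(1)[OF e] u by auto
    ultimately show ?thesis
      using component_ends_subset[OF finH X(1), of e u] that by auto
  qed
  \<comment> \<open>A loop would count twice in the degree; consecutive vertices of a 5-cycle are
    distinct, so none occurs in \<open>F\<close>.\<close>
  have F_no_loop: "ends G e \<noteq> {u}" if "e \<in> F" for e u
  proof -
    obtain X where X: "X \<in> components H" "ends G e \<subseteq> X"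
      using F_ends \<open>e \<in> F\<close> by blast
    obtain v f where v: "bij_betw v {..<5} X" and f: "bij_betw f {..<5} {e \<in> F. ends G e \<subseteq> X}"
      and ends: "\<And>i. i < (5::nat) \<Longrightarrow> ends G (f i) = {v i, v (Suc i mod 5)}"
      using cyc[OF X(1)] unfolding is_cycle_def by auto
    have "e \<in> f ` {..<5}"
      using f \<open>e \<in> F\<close> X(2) by (auto simp: bij_betw_def)
    then obtain i where i: "i < 5" "e = f i"
      by blast
    have "Suc i mod 5 \<noteq> i"
      using i(1) by (auto simp: less_5_cases)
    then have "v (Suc i mod 5) \<noteq> v i"
      using v i(1) by (auto simp: bij_betw_def inj_on_def)
    then show ?thesis
      using ends[OF i(1)] i(2) by auto
  qed

  \<comment> \<open>The six perfect matchings and the count of the covering\<close>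
  define N where "N k = {e. \<exists>X\<in>components H. \<exists>w\<in>X. col w = k \<and> e \<in> Q X w}" for k
  \<comment> \<open>Indices 0 to 4 are the colours; index 5 is free for the complement of
    \<open>F\<close>.\<close>
  define M where "M k = (if k = 5 then edges G - F else {e \<in> edges G - F. c e = k} \<union> N k)" for k
  have N_F: "N k \<subseteq> F" for k
    using Q_sub by (fastforce simp: N_def)
  \<comment> \<open>The end \<open>u\<close> determines the component, since components are
    disjoint, and injectivity of \<open>col\<close> on it then determines \<open>w\<close>.\<close>
  have N_iff: "e \<in> N k \<longleftrightarrow> e \<in> Q X w"
    if "X \<in> components H" "w \<in> X" "col w = k" "u \<in> X" "u \<in> ends G e" for e k X w u
  proof
    assume "e \<in> N k"
    then obtain Y w' where Y: "Y \<in> components H" "w' \<in> Y" "col w' = k" "e \<in> Q Y w'"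
      by (auto simp: N_def)
    then have "u \<in> Y"
      using Q_sub[OF Y(1,2)] that by blast
    then have "Y = X"
      using components_eq Y that by metis
    moreover have "w' = w"
      using \<open>Y = X\<close> Y that col_inj[OF that(1)] by (auto dest: inj_onD)
    ultimately show "e \<in> Q X w"
      using Y by simp
  next
    assume "e \<in> Q X w"
    then show "e \<in> N k"
      using that by (auto simp: N_def)
  qed
  have "perfect_matching G (M k)" if k: "k < 5" for k
    unfolding perfect_matching_iff[OF assms(1)]
  proof (intro conjI ballI)
    have Mk: "M k = {e \<in> edges G - F. c e = k} \<union> N k"
      using k by (simp add: M_def)
    show "M k \<subseteq> edges G"
      using F N_F by (auto simp: Mk)
    fix u assume u: "u \<in> verts G"
    show "ends G e \<noteq> {u}" if "e \<in> M k" for e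
      using that no_loop[OF u] F_no_loop N_F unfolding Mk by blast
    obtain X where X: "X \<in> components H" "u \<in> X"
      using Union_components[of H] u by auto
    obtain w where w: "w \<in> X" "col w = k"
      using col_surj X k by blast
    show "\<exists>!e. e \<in> M k \<and> u \<in> ends G e"
    proof (cases "u = w")
      \<comment> \<open>The matching edge of \<open>w\<close> has colour k and no edge of
        \<open>Q X w\<close> touches \<open>w\<close>, so \<open>m u\<close> is the only
        candidate.\<close>
      case True
      have "e \<notin> N k" if "u \<in> ends G e" for e
        using N_iff[OF X(1) w X(2) that] Q_avoid[OF X(1) w(1)] True that by blast
      moreover have "c (m u) = k"
        using w True by (simp add: col_def)
      ultimately have "e \<in> M k \<and> u \<in> ends G e \<longleftrightarrow> e = m u" for e
        using m[OF u] m_eq[OF u] unfolding Mk by blast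
      then show ?thesis
        by simp
    next
      \<comment> \<open>Here the matching edge at \<open>u\<close> has a colour other than k, so
        \<open>u\<close> must be covered from within its cycle.\<close>
      case False
      then have "col u \<noteq> k"
        using col_inj[OF X(1)] X w by (auto dest: inj_onD)
      then have "c e \<noteq> k" if "e \<in> edges G - F" "u \<in> ends G e" for e
        using m_eq[OF u that] by (simp add: col_def)
      then have "e \<in> M k \<and> u \<in> ends G e \<longleftrightarrow> e \<in> Q X w \<and> u \<in> ends G e" for e
        using N_iff[OF X(1) w X(2)] unfolding Mk by blast
      then show ?thesis
        using Q_ex1[OF X(1) w(1) X(2) False] by simp
    qed
  qed
  then have "perfect_matching G (M k)" if "k < 6" for k
    using that pm by (cases "k = 5") (auto simp: M_def)
  moreover have "card {i. i < 6 \<and> e \<in> M i} = 2" if e: "e \<in> edges G" for e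
  proof (cases "e \<in> F")
    case False
    \<comment> \<open>The two indices differ because colours are below 5.\<close>
    then have "{i. i < 6 \<and> e \<in> M i} = {5, c e}"
      using e c5[of e] N_F by (auto simp: M_def)
    then show ?thesis
      using c5[of e] e False by simp
  next
    case True
    then obtain X u where X: "X \<in> components H" "ends G e \<subseteq> X" and u: "u \<in> ends G e"
      using F_ends by blast
    have "{i. i < 6 \<and> e \<in> M i} = {i. i < 5 \<and> e \<in> N i}"
      using True by (auto simp: M_def)
    \<comment> \<open>Since \<open>col\<close> maps \<open>X\<close> bijectively onto the five
      colours, counting the colours k with e in \<open>N k\<close> amounts to counting the vertices
      w with e in \<open>Q X w\<close>.\<close>
    also have "\<dots> = col ` {w \<in> X. e \<in> Q X w}"
    proof -
      have "col w < 5" if "w \<in> X" for w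
        using c5 m X_sub[OF X(1)] that by (auto simp: col_def)
      moreover have "e \<in> N k \<longleftrightarrow> e \<in> Q X w" if "w \<in> X" "col w = k" for k w
        using N_iff[OF X(1) that _ u] X u by blast
      ultimately show ?thesis
        using col_surj[OF X(1)] by blast
    qed
    also have "card \<dots> = 2"
      using Q_card[OF X(1) True X(2)] inj_on_subset[OF col_inj[OF X(1)]]
      by (subst card_image) auto
    finally show ?thesis .
  qed
  ultimately show ?thesis
    by (auto simp: fulkerson_covering_def)
qed

end
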